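(* Let $C$ be a proper cone in a Banach space $(X,\|\cdot\|)$ and assume that $C$ is a sup-semilattice in the partial ordering induced by $C$. Assume that $h:C\to C$ is continuous, homogeneous and order-preserving in the partial ordering from $C$ and that $\rho_C(h)<r_C(h)$. Assume that there exists an integer $m$ such that if $x\in C\setminus\{0\}$ is any periodic point of $h$, then $\{h^j(x)\mid j\ge0\}$ is contained in the union of at most $m$ parts of $C$, i.e. there exist $u_1,\dots,u_m\in C$ ($u_i$ dependent on $x$) with $$\{h^j(x)\mid j\ge 0\}\subset\bigcup_{i=1}^m C_{u_i}.$$ Then there exists $y\in C\setminus\{0\}$ with $h(y)=ry$, where $r=r_C(h)$.
   Context: A subset $C$ of the real Banach space $X$ is a cone if $tC\subset C$ for all $t\ge 0$; it is proper if it is closed, convex and pointed ($C\cap(-C)=\{0\}$). A proper cone induces the partial order $x\le y\iff y-x\in C$. A subset $D\subset X$ is a sup-semilattice if for all $x,y\in D$ there is $z\in D$ with $x\le z$, $y\le z$, and $z\le w$ for every $w\in D$ with $x\le w$ and $y\le w$. Two elements $x,y\in C$ are comparable, $x\sim y$, if there are constants $a,b>0$ with $ax\le y\le bx$; for $u\in C$, the set $C_u=\{x\in C\mid x\sim u\}$ is called a part of $C$. A map $h:C\to C$ is homogeneous if $h(tx)=th(x)$ for all $t>0$, $x\in C$; it is order-preserving if $x\le y$ implies $h(x)\le h(y)$. $h^n$ denotes the $n$-th iterate of $h$. A periodic point of $h$ is a point $x$ such that $h^n(x)=x$ for some positive integer $n$. Cone spectral radius: $r_C(h)=\sup_{x\in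 C}\limsup_{k\to\infty}\|h^k(x)\|^{1/k}$. Fix a homogeneous generalized measure of noncompactness $\nu$ on $X$, that is, a map $\nu$ from the bounded subsets of $X$ to $[0,\infty)$ such that, for all bounded $A,B\subset X$ and scalars $\lambda$: $\nu(A)=0$ iff $\operatorname{cl}A$ is compact; $\nu(A+B)\le\nu(A)+\nu(B)$; $\nu(\operatorname{cl}\operatorname{conv}A)=\nu(A)$; $\nu(\lambda A)=|\lambda|\nu(A)$; $A\subset B$ implies $\nu(A)\le\nu(B)$. Set $\nu_C(h)=\inf\{\lambda>0\mid \nu(h(A))\le\lambda\nu(A)\text{ for all bounded }A\subset C\}$. The cone essential spectral radius is $\rho_C(h)=\lim_{k\to\infty}\nu_C(h^k)^{1/k}=\inf_{k\ge1}\nu_C(h^k)^{1/k}$. *)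

theory Defs
  imports "HOL-Analysis.Analysis" "HOL-Library.Set_Algebras"
begin

definition proper_cone :: "'a::real_normed_vector set \<Rightarrow> bool" where
  "proper_cone C \<longleftrightarrow> cone C \<and> closed C \<and> convex C \<and> C \<inter> uminus ` C = {0}"

definition cone_le :: "'a::real_vector set \<Rightarrow> 'a \<Rightarrow> 'a \<Rightarrow> bool" where
  "cone_le C x y \<longleftrightarrow> y - x \<in> C"

definition sup_semilattice_on :: "'a::real_vector set \<Rightarrow> 'a set \<Rightarrow> bool" where
  "sup_semilattice_on C D \<longleftrightarrow>
     (\<forall>x\<in>D. \<forall>y\<in>D. \<exists>z\<in>D. cone_le C x z \<and> cone_le C y z \<and>
        (\<forall>w\<in>D. cone_le C x w \<and> cone_le C y w \<longrightarrow> cone_le C z w))"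

definition comparable :: "'a::real_vector set \<Rightarrow> 'a \<Rightarrow> 'a \<Rightarrow> bool" where
  "comparable C x y \<longleftrightarrow>
     (\<exists>a>0. \<exists>b>0. cone_le C (a *\<^sub>R x) y \<and> cone_le C y (b *\<^sub>R x))"

definition cone_part :: "'a::real_vector set \<Rightarrow> 'a \<Rightarrow> 'a set" where
  "cone_part C u = {x \<in> C. comparable C x u}"

definition homogeneous_on :: "'a::real_vector set \<Rightarrow> ('a \<Rightarrow> 'a) \<Rightarrow> bool" where
  "homogeneous_on C h \<longleftrightarrow> (\<forall>x\<in>C. \<forall>t>0. h (t *\<^sub>R x) = t *\<^sub>R h x)"

definition order_preserving_on :: "'a::real_vector set \<Rightarrow> ('a \<Rightarrow> 'a) \<Rightarrow> bool" where
  "order_preserving_on C h \<longleftrightarrow> monotone_on C (cone_le C) (cone_le C) h"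

definition periodic_point :: "('a \<Rightarrow> 'a) \<Rightarrow> 'a \<Rightarrow> bool" where
  "periodic_point h x \<longleftrightarrow> (\<exists>n>0. (h ^^ n) x = x)"

text \<open>Spectral radii take values in \<^typ>\<open>ereal\<close>, so that suprema always exist and an
  infimum over the empty set is \<open>\<infinity>\<close>.  The term \<open>k = 0\<close> is irrelevant to the limes superior.\<close>

definition cone_spectral_radius ::
    "'a::real_normed_vector set \<Rightarrow> ('a \<Rightarrow> 'a) \<Rightarrow> ereal" where
  "cone_spectral_radius C h =
     (SUP x\<in>C. limsup (\<lambda>k. ereal (root k (norm ((h ^^ k) x)))))"

text \<open>The values of \<open>\<nu>\<close> on unbounded sets are unconstrained.\<close>

definition homogeneous_mnc :: "('a::real_normed_vector set \<Rightarrow> real) \<Rightarrow> bool" where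
  "homogeneous_mnc \<nu> \<longleftrightarrow>
     (\<forall>A. bounded A \<longrightarrow> 0 \<le> \<nu> A) \<and>
     (\<forall>A. bounded A \<longrightarrow> (\<nu> A = 0 \<longleftrightarrow> compact (closure A))) \<and>
     (\<forall>A B. bounded A \<longrightarrow> bounded B \<longrightarrow> \<nu> (A + B) \<le> \<nu> A + \<nu> B) \<and>
     (\<forall>A. bounded A \<longrightarrow> \<nu> (closure (convex hull A)) = \<nu> A) \<and>
     (\<forall>A c. bounded A \<longrightarrow> \<nu> ((\<lambda>x. c *\<^sub>R x) ` A) = \<bar>c\<bar> * \<nu> A) \<and>
     (\<forall>A B. bounded B \<longrightarrow> A \<subseteq> B \<longrightarrow> \<nu> A \<le> \<nu> B)"

definition mnc_bound ::
    "('a::real_normed_vector set \<Rightarrow> real) \<Rightarrow> 'a set \<Rightarrow> ('a \<Rightarrow> 'a) \<Rightarrow> ereal" where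
  "mnc_bound \<nu> C h =
     Inf {ereal c | c. c > 0 \<and> (\<forall>A. A \<subseteq> C \<and> bounded A \<longrightarrow> \<nu> (h ` A) \<le> c * \<nu> A)}"

definition ereal_root :: "nat \<Rightarrow> ereal \<Rightarrow> ereal" where
  "ereal_root k x = (case x of ereal a \<Rightarrow> ereal (root k a) | _ \<Rightarrow> x)"

text \<open>\<open>\<rho>\<^sub>C(h)\<close> is both the limit and the infimum of \<open>\<nu>\<^sub>C(h\<^sup>k)\<close> to the power \<open>1/k\<close>; the infimum is
  used because it is meaningful even when some \<open>\<nu>\<^sub>C(h\<^sup>k)\<close> is infinite.\<close>

definition cone_essential_spectral_radius ::
    "('a::real_normed_vector set \<Rightarrow> real) \<Rightarrow> 'a set \<Rightarrow> ('a \<Rightarrow> 'a) \<Rightarrow> ereal" where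
  "cone_essential_spectral_radius \<nu> C h =
     (INF k\<in>{1..}. ereal_root k (mnc_bound \<nu> C (h ^^ k)))"

end

theory Submission imports Defs
begin

text \<open>Let \<open>r = r\<^sub>C(h)\<close>, \<open>f = h/r\<close>, and choose \<open>q\<close> such that \<open>g = f\<^sup>q\<close> satisfies \<open>\<nu>(g(A)) \<le> c \<nu>(A)\<close> with
  \<open>c < 1\<close>. No fixed point index is needed, only monotone iterations normalised at well-chosen
  indices. For \<open>\<lambda> < 1\<close> the iteration \<open>x\<^sub>n\<^sub>+\<^sub>1 = g(x\<^sub>n)/\<lambda> + b\<close>, \<open>x\<^sub>0 = b\<close>, is increasing, and unbounded for
  a suitable \<open>b\<close>. Divide \<open>x\<^sub>0, \<dots>, x\<^sub>n\<close> by \<open>\<parallel>x\<^sub>n\<parallel>\<close>, where \<open>n\<close> is an index with \<open>\<parallel>x\<^sub>k\<parallel> \<le> \<parallel>x\<^sub>n\<parallel>\<close> for all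
  \<open>k \<le> n\<close> and \<open>\<parallel>x\<^sub>n\<parallel>\<close> is large. The set of all vectors so obtained as \<open>\<lambda>\<close> increases to 1 is, up to a
  compact set, contained in a multiple of its own image under \<open>g\<close>, hence relatively compact, and a
  limit point \<open>w\<close> of the last members satisfies \<open>w \<le> g(w)\<close>, \<open>\<parallel>w\<parallel> = 1\<close>. The supremum \<open>u\<close> of
  \<open>w, f(w), \<dots>, f\<^sup>q\<^sup>-\<^sup>1(w)\<close> satisfies \<open>u \<le> f(u)\<close>. Since \<open>r\<^sub>C(f) = 1\<close>, normalising the orbit of \<open>u\<close> at an
  index maximising \<open>\<parallel>f\<^sup>n(u)\<parallel>/\<mu>\<^sup>n\<close> and letting \<open>\<mu>\<close> decrease to 1 gives \<open>v\<close> of norm 1 with \<open>v \<le> f(v)\<close> and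
  \<open>\<parallel>f\<^sup>k(v)\<parallel> \<le> 1\<close> for all \<open>k\<close>. This orbit is increasing and relatively compact, so it converges to a
  nonzero fixed point of \<open>f\<close>.\<close>

section \<open>Measures of noncompactness\<close>

lemma bounded_set_plus:
  fixes A B :: "'a::real_normed_vector set"
  assumes "bounded A" "bounded B" shows "bounded (A + B)"
  using bounded_plus[OF assms] by (rule bounded_subset) (auto simp: set_plus_def)

text \<open>The axioms bound sums, not unions: both \<open>A\<close> and \<open>x\<close> lie in
  \<open>A + {0, x - a}\<close> for any \<open>a \<in> A\<close>, and the finite summand has measure
  zero.\<close>

lemma mnc_insert:
  assumes "homogeneous_mnc \<nu>" "bounded A" "A \<noteq> {}"
  shows "\<nu> (insert x A) \<le> \<nu> A"
proof -
  obtain a where a: "a \<in> A" using assms by auto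
  have "insert x A \<subseteq> A + {0, x - a}"
    using a by (force simp: set_plus_def)
  moreover have "bounded (A + {0, x - a})"
    using assms(2) by (intro bounded_set_plus) simp_all
  ultimately have "\<nu> (insert x A) \<le> \<nu> (A + {0, x - a})"
    using assms(1) by (auto simp: homogeneous_mnc_def)
  also have "\<dots> \<le> \<nu> A + \<nu> {0, x - a}"
    using assms by (auto simp: homogeneous_mnc_def)
  also have "\<nu> {0, x - a} = 0"
    using assms(1) by (auto simp: homogeneous_mnc_def finite_imp_compact finite_imp_closed)
  finally show ?thesis by simp
qed

text \<open>Each \<open>s y\<close> lies on the segment from \<open>0\<close> to \<open>S y\<close>,
  so variable factors stay within \<open>S\<close> times the closed convex hull of
  \<open>insert 0 A\<close>; neither the hull nor the added point raises the measure.\<close>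

lemma mnc_shrink:
  assumes mnc: "homogeneous_mnc \<nu>" and A: "bounded A" "A \<noteq> {}" and S: "0 \<le> S"
    and sub: "Y \<subseteq> {s *\<^sub>R y | s y. 0 \<le> s \<and> s \<le> S \<and> y \<in> A}"
  shows "\<nu> Y \<le> S * \<nu> A" "bounded Y"
proof -
  define D where "D = (\<lambda>x. S *\<^sub>R x) ` (closure (convex hull (insert 0 A)))"
  have bh: "bounded (closure (convex hull (insert 0 A)))"
    using A by (intro bounded_closure bounded_convex_hull) simp
  have bD: "bounded D" unfolding D_def using bh by (rule bounded_scaling)
  have "Y \<subseteq> D"
  proof
    fix z assume "z \<in> Y"
    then obtain s y where z: "z = s *\<^sub>R y" "0 \<le> s" "s \<le> S" "y \<in> A" using sub by blast
    show "z \<in> D"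
    proof (cases "S = 0")
      case True
      have "0 \<in> closure (convex hull (insert 0 A))"
        by (rule subsetD[OF closure_subset]) (simp add: hull_inc)
      then show ?thesis using True z unfolding D_def by auto
    next
      case False
      have "(1 - s / S) *\<^sub>R 0 + (s / S) *\<^sub>R y \<in> convex hull (insert 0 A)"
        using z S False
        by (intro convexD[OF convex_convex_hull]) (auto simp: hull_inc)
      then have "(s / S) *\<^sub>R y \<in> closure (convex hull (insert 0 A))"
        using closure_subset by fastforce
      moreover have "z = S *\<^sub>R ((s / S) *\<^sub>R y)" using z False by simp
      ultimately show ?thesis unfolding D_def by blast
    qed
  qed
  then show "bounded Y" using bD bounded_subset by blast
  have "\<nu> Y \<le> \<nu> D"
    using \<open>Y \<subseteq> D\<close> mnc bD by (auto simp: homogeneous_mnc_def)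
  also have "\<dots> = S * \<nu> (insert 0 A)"
    using mnc A bh S unfolding D_def by (simp add: homogeneous_mnc_def)
  also have "\<dots> \<le> S * \<nu> A"
    using mnc_insert[OF mnc A] S by (rule mult_left_mono)
  finally show "\<nu> Y \<le> S * \<nu> A" .
qed

text \<open>The value \<open>s = 0\<close> is allowed so that the initial members of an orbit can be absorbed in \<open>B\<close>.\<close>

lemma compact_closure_self_image:
  assumes mnc: "homogeneous_mnc \<nu>" and A: "bounded A" "bounded (g ` A)"
    and c: "\<nu> (g ` A) \<le> c * \<nu> A" and S: "0 \<le> S" "S * c < 1"
    and B: "bounded B" "compact (closure B)"
    and rep: "\<And>a. a \<in> A \<Longrightarrow> \<exists>s a' b. 0 \<le> s \<and> s \<le> S \<and> a' \<in> A \<and> b \<in> B \<and> a = s *\<^sub>R g a' + b"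
  shows "compact (closure A)"
proof (cases "A = {}")
  case False
  define Y where "Y = {s *\<^sub>R y | s y. 0 \<le> s \<and> s \<le> S \<and> y \<in> g ` A}"
  have Y: "\<nu> Y \<le> S * \<nu> (g ` A)" "bounded Y"
    using mnc_shrink[OF mnc A(2) _ S(1), of Y] False by (auto simp: Y_def)
  \<comment> \<open>As \<open>\<nu> B = 0\<close>, this inclusion yields
    \<open>\<nu> A \<le> S * c * \<nu> A\<close>, and \<open>S * c < 1\<close> forces
    \<open>\<nu> A = 0\<close>.\<close>
  have "A \<subseteq> Y + B"
  proof
    fix a assume "a \<in> A"
    from rep[OF this] show "a \<in> Y + B"
      unfolding Y_def set_plus_def by blast
  qed
  moreover have bYB: "bounded (Y + B)" using Y B by (intro bounded_set_plus)
  ultimately have "\<nu> A \<le> \<nu> (Y + B)" using mnc by (auto simp: homogeneous_mnc_def)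
  also have "\<dots> \<le> \<nu> Y + \<nu> B" using mnc Y B by (auto simp: homogeneous_mnc_def)
  also have "\<nu> B = 0" using mnc B by (auto simp: homogeneous_mnc_def)
  also have "\<nu> Y + 0 \<le> S * (c * \<nu> A)"
    using Y(1) mult_left_mono[OF c S(1)] by simp
  finally have "(1 - S * c) * \<nu> A \<le> 0" by (simp add: algebra_simps)
  moreover have "0 \<le> \<nu> A" using mnc A by (auto simp: homogeneous_mnc_def)
  ultimately have "\<nu> A = 0" using S(2)
    by (metis diff_gt_0_iff_gt linorder_not_le mult_pos_pos order_antisym_conv)
  then show ?thesis using mnc A by (auto simp: homogeneous_mnc_def)
qed simp

section \<open>Convergent sequences and maximal indices\<close>

lemma compact_closure_subseq:
  fixes X :: "nat \<Rightarrow> 'a::metric_space"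
  assumes "compact (closure A)" "\<And>i. X i \<in> A"
  obtains l \<phi> where "strict_mono (\<phi> :: nat \<Rightarrow> nat)" "(\<lambda>i. X (\<phi> i)) \<longlonglongrightarrow> l"
proof -
  have "\<forall>i. X i \<in> closure A" using assms(2) closure_subset by blast
  then show ?thesis
    using assms(1) that unfolding compact_def comp_def by metis
qed

text \<open>The library's \<open>compact_sequence_with_limit\<close> needs the Heine-Borel property.\<close>

lemma compact_convergent_sequence:
  fixes X :: "nat \<Rightarrow> 'a::topological_space"
  assumes "X \<longlonglongrightarrow> l"
  shows "compact (insert l (range X))"
proof (rule compactI)
  fix \<C> assume \<C>: "\<forall>U\<in>\<C>. open U" "insert l (range X) \<subseteq> \<Union>\<C>"
  then obtain U where U: "U \<in> \<C>" "l \<in> U" by blast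
  then obtain N where N: "\<And>n. n \<ge> N \<Longrightarrow> X n \<in> U"
    using topological_tendstoD[OF assms, of U] \<C>(1) by (auto simp: eventually_sequentially)
  have "\<forall>n. \<exists>V\<in>\<C>. X n \<in> V" using \<C>(2) by blast
  then obtain V where V: "\<And>n. V n \<in> \<C>" "\<And>n. X n \<in> V n" by metis
  show "\<exists>\<C>'\<subseteq>\<C>. finite \<C>' \<and> insert l (range X) \<subseteq> \<Union>\<C>'"
  proof (intro exI[of _ "insert U (V ` {..<N})"] conjI)
    have "X n \<in> \<Union>(insert U (V ` {..<N}))" for n
      using N[of n] V(2)[of n] by (cases "n < N") auto
    then show "insert l (range X) \<subseteq> \<Union>(insert U (V ` {..<N}))" using U(2) by blast
  qed (use U V in auto)
qed

lemma prefix_max: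
  fixes a :: "nat \<Rightarrow> real"
  shows "\<exists>n\<le>m. \<forall>k\<le>m. a k \<le> a n"
proof (induction m)
  case (Suc m)
  then obtain n where "n \<le> m" "\<forall>k\<le>m. a k \<le> a n" by blast
  then show ?case
    by (cases "a n \<le> a (Suc m)") (auto simp: le_Suc_eq intro: order_trans)
qed auto

text \<open>The index of the maximum over a segment that reaches beyond \<open>K\<close> will do.
  Dividing a sequence by its norm at such an index puts all earlier members in the unit
  ball.\<close>

lemma unbounded_record:
  fixes a :: "nat \<Rightarrow> real"
  assumes "\<And>K. \<exists>n. a n > K"
  shows "\<exists>n. a n > K \<and> (\<forall>k\<le>n. a k \<le> a n)"
proof -
  obtain m where m: "a m > K" using assms by blast
  obtain n where "n \<le> m" "\<forall>k\<le>m. a k \<le> a n" using prefix_max by blast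
  then show ?thesis using m by (meson le_trans less_le_trans order_refl)
qed

text \<open>All but finitely many terms lie below \<open>a 0\<close>, so some initial segment
  contains a global maximum. Unlike a record, this controls the later terms too.\<close>

lemma null_sequence_max:
  fixes a :: "nat \<Rightarrow> real"
  assumes "a \<longlonglongrightarrow> 0" "a 0 > 0"
  shows "\<exists>n. \<forall>k. a k \<le> a n"
proof -
  obtain N where N: "\<And>k. k \<ge> N \<Longrightarrow> a k < a 0"
    using order_tendstoD(2)[OF assms] by (auto simp: eventually_sequentially)
  obtain n where n: "\<forall>k\<le>N. a k \<le> a n" using prefix_max by blast
  have "a k \<le> a n" for k
    using n N[of k] by (metis le0 linorder_le_cases order_less_imp_le order_trans)
  then show ?thesis by blast
qed

section \<open>Elementary properties of monotone homogeneous maps on a cone\<close>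

locale cone_map =
  fixes C :: "'a::real_normed_vector set" and f :: "'a \<Rightarrow> 'a"
  assumes proper: "proper_cone C"
    and maps: "f \<in> C \<rightarrow> C"
    and cont: "continuous_on C f"
    and hom: "homogeneous_on C f"
    and mono: "order_preserving_on C f"
begin

lemma cone_scale: "x \<in> C \<Longrightarrow> 0 \<le> t \<Longrightarrow> t *\<^sub>R x \<in> C"
  using proper by (auto simp: proper_cone_def cone_def)

lemma cone_add: "x \<in> C \<Longrightarrow> y \<in> C \<Longrightarrow> x + y \<in> C"
  using proper convex_cone[of C] by (auto simp: proper_cone_def)

lemma cone_zero: "0 \<in> C"
  using proper by (auto simp: proper_cone_def)

lemma cone_pointed: "x \<in> C \<Longrightarrow> - x \<in> C \<Longrightarrow> x = 0"
proof -
  assume "x \<in> C" "- x \<in> C"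
  then have "x \<in> C \<inter> uminus ` C" by (metis IntI image_eqI minus_minus)
  then show "x = 0" using proper by (auto simp: proper_cone_def)
qed

lemma cone_limit: "(\<And>n. X n \<in> C) \<Longrightarrow> X \<longlonglongrightarrow> l \<Longrightarrow> l \<in> C"
  using proper closed_sequentially[of C] by (auto simp: proper_cone_def)

lemma f_in: "x \<in> C \<Longrightarrow> f x \<in> C" using maps by auto

lemma f_zero: "f 0 = 0"
proof -
  have "f ((2::real) *\<^sub>R 0) = (2::real) *\<^sub>R f 0"
    using hom cone_zero unfolding homogeneous_on_def by (meson zero_less_numeral)
  then show ?thesis by (simp add: scaleR_2)
qed

lemma f_scale: "x \<in> C \<Longrightarrow> 0 \<le> t \<Longrightarrow> f (t *\<^sub>R x) = t *\<^sub>R f x"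
  using hom f_zero by (cases "t = 0") (auto simp: homogeneous_on_def)

lemma f_mono: "x \<in> C \<Longrightarrow> y \<in> C \<Longrightarrow> y - x \<in> C \<Longrightarrow> f y - f x \<in> C"
  using mono by (auto simp: order_preserving_on_def monotone_on_def cone_le_def)

lemma f_limit:
  assumes "\<And>n. X n \<in> C" "X \<longlonglongrightarrow> l"
  shows "(\<lambda>n. f (X n)) \<longlonglongrightarrow> f l"
  using continuous_on_tendsto_compose[OF cont assms(2) cone_limit[OF assms]] assms(1) by simp

text \<open>Continuity at \<open>0\<close> bounds \<open>f\<close> on a small ball, and homogeneity
  spreads the bound over the cone. Taking \<open>M \<ge> 1\<close> makes the powers of
  \<open>M\<close> nondecreasing.\<close>

lemma f_norm_bound: "\<exists>M\<ge>1. \<forall>x\<in>C. norm (f x) \<le> M * norm x"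
proof -
  obtain d where d: "d > 0" "\<And>x. x \<in> C \<Longrightarrow> dist x 0 < d \<Longrightarrow> dist (f x) (f 0) < 1"
    using cont cone_zero unfolding continuous_on_iff by (metis zero_less_one)
  have "norm (f x) \<le> (2 / d) * norm x" if x: "x \<in> C" for x
  proof (cases "x = 0")
    case False
    define t where "t = d / 2 / norm x"
    have t: "t > 0" using d False by (simp add: t_def)
    have "norm (t *\<^sub>R x) < d" using False d by (simp add: t_def)
    then have "norm (f (t *\<^sub>R x)) < 1"
      using d(2)[OF cone_scale[OF x, of t]] t f_zero by simp
    then have "t * norm (f x) < 1" using f_scale[OF x, of t] t by simp
    then have "norm (f x) < 1 / t" using t by (simp add: field_simps)
    then show ?thesis using False d by (simp add: t_def field_simps)
  qed (simp add: f_zero)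
  then have "norm (f x) \<le> max 1 (2 / d) * norm x" if "x \<in> C" for x
    using that by (meson max.cobounded2 mult_right_mono norm_ge_zero order_trans)
  then show ?thesis by (intro exI[of _ "max 1 (2 / d)"]) auto
qed

lemma bounded_image:
  assumes "A \<subseteq> C" "bounded A" shows "bounded (f ` A)"
proof -
  obtain M where M: "M \<ge> 1" "\<And>x. x \<in> C \<Longrightarrow> norm (f x) \<le> M * norm x" using f_norm_bound by blast
  obtain K where K: "\<And>x. x \<in> A \<Longrightarrow> norm x \<le> K" using assms(2) by (auto simp: bounded_iff)
  have "norm (f x) \<le> M * K" if "x \<in> A" for x
    using M(2)[of x] mult_left_mono[OF K[OF that], of M] M(1) assms(1) that
    by (meson order_trans subsetD zero_le_one)
  then show ?thesis by (auto simp: bounded_iff)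
qed

lemma iter_in: "x \<in> C \<Longrightarrow> (f ^^ n) x \<in> C"
  by (induction n) (auto intro: f_in)

text \<open>Lets the facts of the locale be reused for \<open>f ^^ q\<close> and
  \<open>f ^^ k\<close>.\<close>

lemma cone_map_iter: "cone_map C (f ^^ n)"
proof (induction n)
  case 0
  show ?case
    using proper
    by unfold_locales
      (auto simp: homogeneous_on_def order_preserving_on_def monotone_on_def continuous_on_id)
next
  case (Suc n)
  interpret I: cone_map C "f ^^ n" by fact
  have "continuous_on C (f \<circ> (f ^^ n))"
    by (intro continuous_on_compose I.cont continuous_on_subset[OF cont]) (auto simp: I.f_in)
  then show ?case
    using proper I.f_in f_in I.f_mono f_mono I.f_scale f_scale
    by unfold_locales
      (auto simp: homogeneous_on_def order_preserving_on_def monotone_on_def cone_le_def o_def)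
qed

lemma cone_map_scale:
  assumes "t > 0" shows "cone_map C (\<lambda>x. t *\<^sub>R f x)"
proof
  show "order_preserving_on C (\<lambda>x. t *\<^sub>R f x)"
    unfolding order_preserving_on_def monotone_on_def cone_le_def
    using cone_scale[OF f_mono, of _ _ t] assms by (auto simp: scaleR_diff_right)
qed (use proper assms f_in cont f_scale cone_scale in
    \<open>auto simp: homogeneous_on_def intro!: continuous_intros\<close>)

lemma iter_scale: "x \<in> C \<Longrightarrow> 0 \<le> t \<Longrightarrow> (f ^^ n) (t *\<^sub>R x) = t *\<^sub>R (f ^^ n) x"
  using cone_map.f_scale[OF cone_map_iter] by blast

lemma scaled_iter:
  assumes "x \<in> C" "t > 0"
  shows "((\<lambda>x. t *\<^sub>R f x) ^^ n) x = t ^ n *\<^sub>R (f ^^ n) x"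
  by (induction n) (use assms f_scale iter_in in auto)

lemma iter_incr:
  assumes "u \<in> C" "f u - u \<in> C" "m \<le> n"
  shows "(f ^^ n) u - (f ^^ m) u \<in> C"
  using assms(3)
proof (induction rule: dec_induct)
  case base then show ?case by (simp add: cone_zero)
next
  case (step k)
  have "(f ^^ k) (f u) - (f ^^ k) u \<in> C"
    using cone_map.f_mono[OF cone_map_iter] assms f_in by blast
  from cone_add[OF this step.IH] show ?case by (simp add: funpow_swap1)
qed

end


section \<open>A subeigenvector of a condensing map\<close>

locale condensing_cone_map = cone_map C g
  for C :: "'a::real_normed_vector set" and g +
  fixes \<nu> :: "'a set \<Rightarrow> real" and c :: real
  assumes mnc: "homogeneous_mnc \<nu>"
    and c_pos: "0 < c" and c_less: "c < 1"
    and condensing: "\<And>A. A \<subseteq> C \<Longrightarrow> bounded A \<Longrightarrow> \<nu> (g ` A) \<le> c * \<nu> A"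
begin

text \<open>The source of every limit vector below. Since \<open>c < 1\<close>, some factors
  \<open>S > 1\<close> are admissible, which covers \<open>g\<close> divided by any
  \<open>lam\<close> with \<open>c < lam < 1\<close>.\<close>

lemma self_image_subseq:
  assumes A: "A \<subseteq> C" "bounded A" and S: "0 \<le> S" "S * c < 1"
    and B: "bounded B" "compact (closure B)"
    and rep: "\<And>a. a \<in> A \<Longrightarrow> \<exists>s a' b. 0 \<le> s \<and> s \<le> S \<and> a' \<in> A \<and> b \<in> B \<and> a = s *\<^sub>R g a' + b"
    and X: "\<And>i. X i \<in> A"
  obtains l \<phi> where "strict_mono (\<phi> :: nat \<Rightarrow> nat)" "(\<lambda>i. X (\<phi> i)) \<longlonglongrightarrow> l" "l \<in> C"
proof -
  have "compact (closure A)"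
    by (rule compact_closure_self_image[OF mnc A(2) bounded_image[OF A] condensing[OF A] S B rep])
  then obtain l \<phi> where l: "strict_mono (\<phi> :: nat \<Rightarrow> nat)" "(\<lambda>i. X (\<phi> i)) \<longlonglongrightarrow> l"
    using compact_closure_subseq[of A X] X by blast
  moreover have "l \<in> C" using cone_limit[OF _ l(2)] X A(1) by blast
  ultimately show ?thesis using that by blast
qed

text \<open>The cone need not be normal, so \<open>Y n \<le> X n\<close> with \<open>Y\<close> unbounded does not by itself make \<open>X\<close>
  unbounded: if \<open>X\<close> were bounded, a limit point \<open>w\<close> of normalised members of \<open>Y\<close> would satisfy
  \<open>w \<le> 0\<close> and \<open>\<parallel>w\<parallel> = 1\<close>.\<close>

lemma unbounded_affine_iteration:
  assumes lam: "c < lam" and x: "x \<in> C"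
    and unbdd: "\<And>K. \<exists>n. norm ((g ^^ n) x) / lam ^ n > K"
  defines "X \<equiv> \<lambda>n. ((\<lambda>y. (1 / lam) *\<^sub>R g y + x) ^^ n) x"
  shows "\<exists>n. norm (X n) > K"
proof (rule ccontr)
  assume "\<nexists>n. norm (X n) > K"
  then have K: "norm (X n) \<le> K" for n by (meson not_less)
  have lam0: "0 < lam" using lam c_pos by simp
  interpret G: cone_map C "\<lambda>y. (1 / lam) *\<^sub>R g y"
    using lam0 by (intro cone_map_scale) simp
  define Y where "Y n = ((\<lambda>y. (1 / lam) *\<^sub>R g y) ^^ n) x" for n
  have Y_in: "Y n \<in> C" for n unfolding Y_def using x by (rule G.iter_in)
  have Y_Suc: "Y (Suc n) = (1 / lam) *\<^sub>R g (Y n)" for n by (simp add: Y_def)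
  have X_Suc: "X (Suc n) = (1 / lam) *\<^sub>R g (X n) + x" for n by (simp add: X_def)
  have X_in: "X n \<in> C" for n
  proof (induction n)
    case 0 then show ?case using x by (simp add: X_def)
  next
    case (Suc n) then show ?case unfolding X_Suc using G.f_in x cone_add by blast
  qed
  have YX: "X n - Y n \<in> C" for n
  proof (induction n)
    case 0 then show ?case using cone_zero by (simp add: X_def Y_def)
  next
    case (Suc n)
    have "(1 / lam) *\<^sub>R g (X n) - (1 / lam) *\<^sub>R g (Y n) + x \<in> C"
      using cone_add[OF G.f_mono[OF Y_in X_in Suc] x] .
    then show ?case unfolding X_Suc Y_Suc by (simp add: algebra_simps)
  qed
  have "norm (Y n) = norm ((g ^^ n) x) / lam ^ n" for n
    unfolding Y_def using scaled_iter[OF x, of "1 / lam" n] lam0 by (simp add: power_divide)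
  then have "\<And>K. \<exists>n. norm (Y n) > K" using unbdd by simp
  from unbounded_record[OF this]
  have "\<forall>i. \<exists>n. norm (Y n) > real (Suc i) \<and> (\<forall>k\<le>n. norm (Y k) \<le> norm (Y n))" by blast
  then obtain N where N: "\<And>i. norm (Y (N i)) > real (Suc i)"
    "\<And>i k. k \<le> N i \<Longrightarrow> norm (Y k) \<le> norm (Y (N i))" by metis
  have N1: "1 < norm (Y (N i))" for i using N(1)[of i] by simp
  then have N0: "0 < norm (Y (N i))" for i by (meson less_trans zero_less_one)
  have inv0: "(\<lambda>i. 1 / norm (Y (N i))) \<longlonglongrightarrow> 0"
  proof (rule tendsto_sandwich[of "\<lambda>_. 0" _ _ "\<lambda>i. 1 / real (Suc i)"])
    show "\<forall>\<^sub>F i in sequentially. 1 / norm (Y (N i)) \<le> 1 / real (Suc i)"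
      by (rule always_eventually, rule allI, rule divide_left_mono)
         (use N(1) N0 in \<open>auto intro: less_imp_le\<close>)
    show "(\<lambda>i. 1 / real (Suc i)) \<longlonglongrightarrow> 0"
      by (rule LIMSEQ_Suc[OF lim_1_over_n])
  qed auto
  \<comment> \<open>Whole rescaled initial segments enter, not only their last members, so that each
    member with \<open>k > 0\<close> is \<open>1 / lam\<close> times the \<open>g\<close>-image of a
    member. Those with \<open>k = 0\<close> are multiples of \<open>x\<close> by at most 1 and lie
    in \<open>B\<close>.\<close>
  define A where "A = {(1 / norm (Y (N i))) *\<^sub>R Y k | i k. k \<le> N i}"
  define B where "B = (\<lambda>t. t *\<^sub>R x) ` {0..1::real}"
  have AC: "A \<subseteq> C" unfolding A_def using Y_in cone_scale by auto
  have "norm a \<le> 1" if "a \<in> A" for a using that N(2) N0 by (auto simp: A_def)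
  then have bA: "bounded A" by (auto simp: bounded_iff)
  have "compact B" unfolding B_def
    by (intro compact_continuous_image continuous_intros) simp
  then have B: "bounded B" "compact (closure B)"
    by (auto simp: compact_imp_bounded compact_imp_closed)
  have rep: "\<exists>s a' b. 0 \<le> s \<and> s \<le> 1 / lam \<and> a' \<in> A \<and> b \<in> B \<and> a = s *\<^sub>R g a' + b"
    if aA: "a \<in> A" for a
  proof -
    obtain i k where a: "a = (1 / norm (Y (N i))) *\<^sub>R Y k" "k \<le> N i" using aA by (auto simp: A_def)
    show ?thesis
    proof (cases k)
      case 0
      have "1 / norm (Y (N i)) \<le> 1" using N1[of i] N0[of i] by (subst pos_divide_le_eq) auto
      then have "a \<in> B" unfolding B_def
        using a 0 by (intro image_eqI[of _ _ "1 / norm (Y (N i))"]) (simp_all, simp add: Y_def)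
      then show ?thesis using aA lam0 by (intro exI[of _ 0] exI[of _ a]) auto
    next
      case (Suc j)
      have "j \<le> N i" using a Suc by simp
      then have "(1 / norm (Y (N i))) *\<^sub>R Y j \<in> A" unfolding A_def by blast
      moreover have "0 \<in> B" by (auto simp: B_def intro!: image_eqI[of _ _ 0])
      moreover have "a = (1 / lam) *\<^sub>R g ((1 / norm (Y (N i))) *\<^sub>R Y j) + 0"
        using a Suc Y_Suc f_scale[OF Y_in, of "1 / norm (Y (N i))" j] by simp
      moreover have "0 \<le> 1 / lam" using lam0 by simp
      ultimately show ?thesis by blast
    qed
  qed
  have "1 / lam * c < 1" using lam lam0 by simp
  moreover have "0 \<le> 1 / lam" using lam0 by simp
  moreover have "(1 / norm (Y (N i))) *\<^sub>R Y (N i) \<in> A" for i by (auto simp: A_def)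
  ultimately obtain w \<phi> where w: "strict_mono (\<phi> :: nat \<Rightarrow> nat)"
    "(\<lambda>i. (1 / norm (Y (N (\<phi> i)))) *\<^sub>R Y (N (\<phi> i))) \<longlonglongrightarrow> w" "w \<in> C"
    using self_image_subseq[OF AC bA _ _ B rep, of "\<lambda>i. (1 / norm (Y (N i))) *\<^sub>R Y (N i)"] by blast
  \<comment> \<open>The supposed bound \<open>K\<close> makes the rescaled \<open>X\<close> vanish
    in the limit, so the rescaled differences \<open>X - Y\<close>, which lie in \<open>C\<close>,
    tend to \<open>- w\<close>.\<close>
  have "(\<lambda>i. 1 / norm (Y (N (\<phi> i))) * K) \<longlonglongrightarrow> 0"
    using tendsto_mult_right[OF LIMSEQ_subseq_LIMSEQ[OF inv0 w(1)], of K] by (simp add: o_def)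
  then have "(\<lambda>i. (1 / norm (Y (N (\<phi> i)))) *\<^sub>R X (N (\<phi> i))) \<longlonglongrightarrow> 0"
    by (rule Lim_null_comparison[rotated])
       (auto intro!: always_eventually divide_right_mono K)
  from tendsto_diff[OF this w(2)]
  have "(\<lambda>i. (1 / norm (Y (N (\<phi> i)))) *\<^sub>R (X (N (\<phi> i)) - Y (N (\<phi> i)))) \<longlonglongrightarrow> - w"
    by (simp add: scaleR_diff_right)
  then have "- w \<in> C" by (rule cone_limit[rotated]) (auto intro: cone_scale YX)
  then have "w = 0" using cone_pointed w(3) by blast
  moreover have "(\<lambda>i. norm ((1 / norm (Y (N (\<phi> i)))) *\<^sub>R Y (N (\<phi> i)))) = (\<lambda>_. 1)"
    using N0 by (auto simp: fun_eq_iff)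
  then have "norm w = 1" using tendsto_norm[OF w(2)] LIMSEQ_unique[OF tendsto_const, of 1] by metis
  ultimately show False by simp
qed

text \<open>The affine iteration is increasing: its first step adds a vector of \<open>C\<close>,
  and monotonicity propagates this. Dividing by the norm at a large record makes the inhomogeneity
  \<open>b\<close> small, and the last step says \<open>v n \<le> g (v n) / lam + b\<close>.\<close>

lemma approximate_subeigenvector:
  assumes lam: "c < lam" and x: "x \<in> C" and eps: "0 < \<epsilon>"
    and unbdd: "\<And>K. \<exists>n. norm ((g ^^ n) x) / lam ^ n > K"
  shows "\<exists>v n b. (\<forall>k. v k \<in> C) \<and> (\<forall>k\<le>n. norm (v k) \<le> 1) \<and> norm (v n) = 1 \<and>
    norm b \<le> \<epsilon> \<and> v 0 = b \<and> (\<forall>k. v (Suc k) = (1 / lam) *\<^sub>R g (v k) + b) \<and>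
    v (Suc n) - v n \<in> C"
proof -
  have lam0: "0 < lam" using lam c_pos by simp
  interpret G: cone_map C "\<lambda>y. (1 / lam) *\<^sub>R g y"
    using lam0 by (intro cone_map_scale) simp
  define X where "X n = ((\<lambda>y. (1 / lam) *\<^sub>R g y + x) ^^ n) x" for n
  have X_Suc: "X (Suc n) = (1 / lam) *\<^sub>R g (X n) + x" for n by (simp add: X_def)
  have X_0: "X 0 = x" by (simp add: X_def)
  have X_in: "X n \<in> C" for n
    by (induction n) (auto simp: X_0 X_Suc x intro!: cone_add G.f_in)
  have X_incr: "X (Suc n) - X n \<in> C" for n
  proof (induction n)
    case 0 show ?case using G.f_in[OF x] by (simp add: X_Suc X_0)
  next
    case (Suc n)
    from G.f_mono[OF X_in X_in this] show ?case by (simp add: X_Suc)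
  qed
  have "\<And>K. \<exists>n. norm (X n) > K"
    unfolding X_def using unbounded_affine_iteration[OF lam x unbdd] .
  \<comment> \<open>Exceeding \<open>norm x / \<epsilon>\<close> is what makes the rescaled
    \<open>x\<close>, the future \<open>b\<close>, of norm at most
    \<open>\<epsilon>\<close>.\<close>
  from unbounded_record[OF this] obtain n where n: "norm (X n) > max 0 (norm x / \<epsilon>)"
    "\<And>k. k \<le> n \<Longrightarrow> norm (X k) \<le> norm (X n)" by blast
  define t where "t = 1 / norm (X n)"
  have t: "t > 0" using n(1) by (simp add: t_def)
  show ?thesis
  proof (intro exI[of _ "\<lambda>k. t *\<^sub>R X k"] exI[of _ n] exI[of _ "t *\<^sub>R x"] conjI allI impI)
    show "norm (t *\<^sub>R X k) \<le> 1" if "k \<le> n" for k using n that by (simp add: t_def)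
    show "norm (t *\<^sub>R X n) = 1" using n by (simp add: t_def)
    show "norm (t *\<^sub>R x) \<le> \<epsilon>" using n eps t by (simp add: t_def pos_divide_le_eq pos_divide_less_eq less_imp_le mult.commute)
    show "t *\<^sub>R X (Suc k) = (1 / lam) *\<^sub>R g (t *\<^sub>R X k) + t *\<^sub>R x" for k
      using t f_scale[OF X_in, of t k] by (simp add: X_Suc scaleR_add_right)
    show "t *\<^sub>R X (Suc n) - t *\<^sub>R X n \<in> C"
      using cone_scale[OF X_incr, of t n] t by (simp add: scaleR_diff_right)
  qed (use t X_in cone_scale X_0 in auto)
qed

text \<open>As \<open>lam\<close> increases to 1 and \<open>b\<close> tends to 0, the approximate
  inequalities become \<open>w \<le> g w\<close>. Compactness is obtained for the segments of all
  \<open>lam\<close> at once.\<close>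

lemma subeigenvector_exists:
  assumes growth: "\<And>lam. 0 < lam \<Longrightarrow> lam < 1 \<Longrightarrow> \<exists>x\<in>C. \<forall>K. \<exists>n. norm ((g ^^ n) x) / lam ^ n > K"
  shows "\<exists>w\<in>C - {0}. g w - w \<in> C"
proof -
  \<comment> \<open>A midpoint between \<open>c\<close> and 1: \<open>1 / lam0\<close> is an
    admissible factor that bounds \<open>1 / lam j\<close> for every \<open>j\<close>.\<close>
  define lam0 where "lam0 = (1 + c) / 2"
  have lam0: "c < lam0" "lam0 < 1" "0 < lam0" using c_pos c_less by (auto simp: lam0_def)
  define lam where "lam j = 1 - (1 - lam0) / real (Suc j)" for j
  have lam_ge: "lam0 \<le> lam j" for j
    using lam0 divide_left_mono[of 1 "real (Suc j)" "1 - lam0"] by (simp add: lam_def)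
  have lam_less: "lam j < 1" for j using lam0 by (simp add: lam_def)
  have "(\<lambda>j. (1 - lam0) / real (Suc j)) \<longlonglongrightarrow> 0"
    by (rule LIMSEQ_Suc[OF lim_const_over_n])
  from tendsto_diff[OF tendsto_const[of 1] this] have lam_lim: "lam \<longlonglongrightarrow> 1" by (simp add: lam_def[abs_def])
  have "\<forall>j. \<exists>v n b. (\<forall>k. v k \<in> C) \<and> (\<forall>k\<le>n. norm (v k) \<le> 1) \<and> norm (v n) = 1 \<and>
    norm b \<le> 1 / real (Suc j) \<and> v 0 = b \<and> (\<forall>k. v (Suc k) = (1 / lam j) *\<^sub>R g (v k) + b) \<and>
    v (Suc n) - v n \<in> C"
  proof
    fix j
    obtain x where "x \<in> C" "\<And>K. \<exists>n. norm ((g ^^ n) x) / lam j ^ n > K"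
      using growth[of "lam j"] lam_ge[of j] lam_less[of j] lam0 by fastforce
    then show "\<exists>v n b. (\<forall>k. v k \<in> C) \<and> (\<forall>k\<le>n. norm (v k) \<le> 1) \<and> norm (v n) = 1 \<and>
      norm b \<le> 1 / real (Suc j) \<and> v 0 = b \<and> (\<forall>k. v (Suc k) = (1 / lam j) *\<^sub>R g (v k) + b) \<and>
      v (Suc n) - v n \<in> C"
      using lam_ge[of j] lam0 by (intro approximate_subeigenvector) auto
  qed
  from choice[OF this] obtain v where
    "\<forall>j. \<exists>n b. (\<forall>k. v j k \<in> C) \<and> (\<forall>k\<le>n. norm (v j k) \<le> 1) \<and> norm (v j n) = 1 \<and>
    norm b \<le> 1 / real (Suc j) \<and> v j 0 = b \<and> (\<forall>k. v j (Suc k) = (1 / lam j) *\<^sub>R g (v j k) + b) \<and>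
    v j (Suc n) - v j n \<in> C" by blast
  from choice[OF this] obtain n where
    "\<forall>j. \<exists>b. (\<forall>k. v j k \<in> C) \<and> (\<forall>k\<le>n j. norm (v j k) \<le> 1) \<and> norm (v j (n j)) = 1 \<and>
    norm b \<le> 1 / real (Suc j) \<and> v j 0 = b \<and> (\<forall>k. v j (Suc k) = (1 / lam j) *\<^sub>R g (v j k) + b) \<and>
    v j (Suc (n j)) - v j (n j) \<in> C" by blast
  from choice[OF this] obtain b where v_in: "\<And>j k. v j k \<in> C"
    and v_le: "\<And>j k. k \<le> n j \<Longrightarrow> norm (v j k) \<le> 1" and v_1: "\<And>j. norm (v j (n j)) = 1"
    and b: "\<And>j. norm (b j) \<le> 1 / real (Suc j)" and v_0: "\<And>j. v j 0 = b j"
    and v_Suc: "\<And>j k. v j (Suc k) = (1 / lam j) *\<^sub>R g (v j k) + b j"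
    and v_incr: "\<And>j. v j (Suc (n j)) - v j (n j) \<in> C" by blast
  have b_lim: "b \<longlonglongrightarrow> 0"
    by (rule Lim_null_comparison[OF _ LIMSEQ_Suc[OF lim_1_over_n]]) (use b in auto)
  define A where "A = {v j k | j k. k \<le> n j}"
  \<comment> \<open>Adding the limit 0 makes the set of all \<open>b j\<close> compact. It contains
    the initial members \<open>v j 0 = b j\<close>.\<close>
  define B where "B = insert 0 (range b)"
  have AC: "A \<subseteq> C" unfolding A_def using v_in by auto
  have bA: "bounded A" using v_le by (auto simp: A_def bounded_iff)
  have "compact B" unfolding B_def using compact_convergent_sequence[OF b_lim] .
  then have B: "bounded B" "compact (closure B)"
    by (auto simp: compact_imp_bounded compact_imp_closed)
  have rep: "\<exists>s a' b. 0 \<le> s \<and> s \<le> 1 / lam0 \<and> a' \<in> A \<and> b \<in> B \<and> a = s *\<^sub>R g a' + b"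
    if aA: "a \<in> A" for a
  proof -
    obtain j k where a: "a = v j k" "k \<le> n j" using aA by (auto simp: A_def)
    show ?thesis
    proof (cases k)
      case 0
      then show ?thesis using a aA lam0 v_0 by (intro exI[of _ 0] exI[of _ a]) (auto simp: B_def)
    next
      case (Suc i)
      have "i \<le> n j" using a Suc by simp
      then have "v j i \<in> A" unfolding A_def by blast
      moreover have "1 / lam j \<le> 1 / lam0" "0 \<le> 1 / lam j"
        using lam_ge[of j] lam0 by (auto intro!: divide_left_mono)
      moreover have "b j \<in> B" by (simp add: B_def)
      moreover have "a = (1 / lam j) *\<^sub>R g (v j i) + b j" using a Suc v_Suc[of j i] by simp
      ultimately show ?thesis by blast
    qed
  qed
  have "1 / lam0 * c < 1" "0 \<le> 1 / lam0" using lam0 by simp_all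
  moreover have "v j (n j) \<in> A" for j by (auto simp: A_def)
  ultimately obtain w \<phi> where w: "strict_mono (\<phi> :: nat \<Rightarrow> nat)"
    "(\<lambda>j. v (\<phi> j) (n (\<phi> j))) \<longlonglongrightarrow> w" "w \<in> C"
    using self_image_subseq[OF AC bA _ _ B rep, of "\<lambda>j. v j (n j)"] by blast
  have "norm w = 1" using tendsto_norm[OF w(2)] v_1 LIMSEQ_unique[OF tendsto_const, of 1] by simp
  moreover have "g w - w \<in> C"
  proof (rule cone_limit[OF v_incr])
    have "(\<lambda>j. (1 / lam (\<phi> j)) *\<^sub>R g (v (\<phi> j) (n (\<phi> j))) + b (\<phi> j) - v (\<phi> j) (n (\<phi> j)))
      \<longlonglongrightarrow> (1 / 1) *\<^sub>R g w + 0 - w"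
      using LIMSEQ_subseq_LIMSEQ[OF lam_lim w(1)] LIMSEQ_subseq_LIMSEQ[OF b_lim w(1)] w(2)
        f_limit[OF v_in w(2)]
      by (intro tendsto_intros) (auto simp: o_def)
    then show "(\<lambda>j. v (\<phi> j) (Suc (n (\<phi> j))) - v (\<phi> j) (n (\<phi> j))) \<longlonglongrightarrow> g w - w"
      by (simp add: v_Suc)
  qed
  ultimately show ?thesis using w(3) by (intro bexI[of _ w]) auto
qed

end


section \<open>From a subeigenvector of an iterate to a fixed point\<close>

context cone_map
begin

lemma finite_sup_exists:
  assumes sup: "sup_semilattice_on C C" and v: "\<And>i. i < (k::nat) \<Longrightarrow> v i \<in> C"
  shows "\<exists>z\<in>C. (\<forall>i<k. z - v i \<in> C) \<and> (\<forall>y\<in>C. (\<forall>i<k. y - v i \<in> C) \<longrightarrow> y - z \<in> C)"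
  using v
proof (induction k)
  case 0
  \<comment> \<open>\<open>0\<close> is the least element of \<open>C\<close>, hence the supremum of
    the empty family.\<close>
  show ?case by (rule bexI[OF _ cone_zero]) simp
next
  case (Suc k)
  then obtain z where z: "z \<in> C" "\<forall>i<k. z - v i \<in> C"
    "\<forall>y\<in>C. (\<forall>i<k. y - v i \<in> C) \<longrightarrow> y - z \<in> C" by auto
  obtain z' where z': "z' \<in> C" "z' - z \<in> C" "z' - v k \<in> C"
    "\<And>y. y \<in> C \<Longrightarrow> y - z \<in> C \<Longrightarrow> y - v k \<in> C \<Longrightarrow> y - z' \<in> C"
    using sup z(1) Suc.prems[of k] unfolding sup_semilattice_on_def cone_le_def by (metis lessI)
  have "z' - v i \<in> C" if "i < Suc k" for i
  proof (cases "i = k")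
    case False
    then have "(z' - z) + (z - v i) \<in> C" using z' z that by (intro cone_add) auto
    then show ?thesis by simp
  qed (use z' in simp)
  then show ?case using z z' by (intro bexI[of _ z']) auto
qed

text \<open>If \<open>u\<close> is the supremum of the first \<open>q\<close> orbit points of
  \<open>w\<close>, then \<open>f u\<close> dominates their images. The last image dominates
  \<open>w\<close> itself, so \<open>f u\<close> is an upper bound of the same points. Finally
  \<open>u \<ge> w\<close> excludes \<open>u = 0\<close>.\<close>

lemma subeigenvector_of_iterate:
  assumes sup: "sup_semilattice_on C C"
    and w: "w \<in> C - {0}" "(f ^^ q) w - w \<in> C" and q: "0 < q"
  shows "\<exists>u\<in>C - {0}. f u - u \<in> C"
proof -
  obtain u where u: "u \<in> C" "\<And>i. i < q \<Longrightarrow> u - (f ^^ i) w \<in> C"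
    "\<And>y. y \<in> C \<Longrightarrow> (\<And>i. i < q \<Longrightarrow> y - (f ^^ i) w \<in> C) \<Longrightarrow> y - u \<in> C"
    using finite_sup_exists[OF sup, of q "\<lambda>i. (f ^^ i) w"] iter_in[of w] w(1) by auto
  have step: "f u - (f ^^ Suc i) w \<in> C" if "i < q" for i
    using f_mono[OF iter_in u(1) u(2)[OF that]] w by simp
  have "f u - (f ^^ i) w \<in> C" if i: "i < q" for i
  proof (cases i)
    case 0
    have "(f u - (f ^^ q) w) + ((f ^^ q) w - w) \<in> C"
      using step[of "q - 1"] q w by (intro cone_add) simp_all
    then show ?thesis using 0 by simp
  qed (use step i in auto)
  then have "f u - u \<in> C" using u f_in by blast
  moreover have "u \<noteq> 0" using u(2)[OF q] w(1) cone_pointed[of w] by auto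
  ultimately show ?thesis using u(1) by auto
qed

text \<open>Past its first \<open>q\<close> points, the orbit is its own image under
  \<open>f ^^ q\<close>, so it has a convergent subsequence. As the orbit increases, the limit
  \<open>l\<close> satisfies \<open>l \<le> f l\<close> and \<open>f l \<le> l\<close>, while
  \<open>l \<ge> w\<close> keeps it away from 0.\<close>

lemma fixed_point_of_bounded_orbit:
  assumes cond: "condensing_cone_map C (f ^^ q) \<nu> c"
    and w: "w \<in> C - {0}" "f w - w \<in> C" and bdd: "\<And>k. norm ((f ^^ k) w) \<le> K"
  shows "\<exists>y\<in>C - {0}. f y = y"
proof -
  interpret G: condensing_cone_map C "f ^^ q" \<nu> c by fact
  define A where "A = range (\<lambda>k. (f ^^ k) w)"
  define B where "B = insert 0 ((\<lambda>k. (f ^^ k) w) ` {..<q})"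
  have A: "A \<subseteq> C" "bounded A" using iter_in w bdd by (auto simp: A_def bounded_iff)
  have "compact B" by (simp add: B_def finite_imp_compact)
  then have B: "bounded B" "compact (closure B)"
    by (auto simp: compact_imp_bounded compact_imp_closed)
  have rep: "\<exists>s a' b. 0 \<le> s \<and> s \<le> 1 \<and> a' \<in> A \<and> b \<in> B \<and> a = s *\<^sub>R (f ^^ q) a' + b"
    if aA: "a \<in> A" for a
  proof -
    obtain k where a: "a = (f ^^ k) w" using aA by (auto simp: A_def)
    show ?thesis
    proof (cases "k < q")
      case True
      then have "a \<in> B" using a by (auto simp: B_def)
      then show ?thesis using aA by (intro exI[of _ 0] exI[of _ a]) auto
    next
      case False
      then have "a = 1 *\<^sub>R (f ^^ q) ((f ^^ (k - q)) w) + 0"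
        using a by (simp flip: funpow_add comp_apply[of "f ^^ q"])
      moreover have "0 \<in> B" "(f ^^ (k - q)) w \<in> A" by (auto simp: A_def B_def)
      ultimately show ?thesis by (metis order_refl zero_le_one)
    qed
  qed
  have "(f ^^ i) w \<in> A" for i by (auto simp: A_def)
  then obtain l \<phi> where l: "strict_mono (\<phi> :: nat \<Rightarrow> nat)"
    "(\<lambda>i. (f ^^ \<phi> i) w) \<longlonglongrightarrow> l" "l \<in> C"
    using G.self_image_subseq[OF A _ _ B rep, of "\<lambda>i. (f ^^ i) w"] G.c_less
    by (metis mult_1 zero_le_one)
  have w_in: "w \<in> C" using w by simp
  note incr = iter_incr[OF w_in w(2)]
  have fl: "(\<lambda>i. (f ^^ Suc (\<phi> i)) w) \<longlonglongrightarrow> f l"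
    using f_limit[OF iter_in[OF w_in] l(2)] by simp
  have "f l - l \<in> C"
    by (rule cone_limit[OF _ tendsto_diff[OF fl l(2)]]) (rule incr, simp)
  \<comment> \<open>Since \<open>\<phi> (Suc i) \<ge> Suc (\<phi> i)\<close>, the next point of the
    subsequence dominates the image of the current one.\<close>
  moreover have "l - f l \<in> C"
    by (rule cone_limit[OF _ tendsto_diff[OF LIMSEQ_Suc[OF l(2)] fl]])
       (rule incr, use l(1) in \<open>simp add: strict_mono_Suc_iff Suc_leI\<close>)
  ultimately have "f l = l" using cone_pointed[of "f l - l"] by simp
  moreover have "l - w \<in> C"
    by (rule cone_limit[OF _ tendsto_diff[OF l(2) tendsto_const]]) (use incr[of 0] in simp)
  then have "l \<noteq> 0" using cone_pointed[OF w_in] w(1) by auto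
  ultimately show ?thesis using l(3) by blast
qed

text \<open>The orbit of \<open>u\<close> may be unbounded. Damping it by powers of
  \<open>lam i > 1\<close> gives its norms a global maximum; normalising there and letting
  \<open>lam i\<close> tend to 1 gives a subeigenvector of norm 1 whose orbit is bounded by
  1.\<close>

lemma fixed_point_of_subeigenvector:
  assumes cond: "condensing_cone_map C (f ^^ q) \<nu> c" and q: "0 < q"
    and u: "u \<in> C - {0}" "f u - u \<in> C"
    and growth: "\<And>lam. 1 < lam \<Longrightarrow> (\<lambda>n. norm ((f ^^ n) u) / lam ^ n) \<longlonglongrightarrow> 0"
  shows "\<exists>y\<in>C - {0}. f y = y"
proof -
  interpret G: condensing_cone_map C "f ^^ q" \<nu> c by fact
  define z where "z n = (f ^^ n) u" for n
  have u_in: "u \<in> C" and u0: "norm u > 0" using u by auto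
  have z_in: "z n \<in> C" for n using iter_in u_in by (simp add: z_def)
  define lam where "lam i = 1 + 1 / real (Suc i)" for i
  have lam1: "1 < lam i" for i by (simp add: lam_def)
  then have lam0: "0 < lam i" for i by (meson less_trans zero_less_one)
  have lam_lim: "lam \<longlonglongrightarrow> 1"
    using tendsto_add[OF tendsto_const[of 1] LIMSEQ_Suc[OF lim_1_over_n]]
    by (simp add: lam_def[abs_def])
  have "\<exists>n. \<forall>k. norm (z k) / lam i ^ k \<le> norm (z n) / lam i ^ n" for i
    using null_sequence_max[OF growth[OF lam1]] u0 unfolding z_def by simp
  then obtain N where N: "\<And>i k. norm (z k) / lam i ^ k \<le> norm (z (N i)) / lam i ^ N i"
    by metis
  \<comment> \<open>These scalars bring every \<open>z k\<close> into the unit ball and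
    \<open>z (N i)\<close> onto its boundary. Advancing \<open>k\<close> by \<open>q\<close> divides
    them by \<open>lam i ^ q\<close>, so the factor needed in \<open>rep\<close> is at most
    1.\<close>
  define T where "T i k = 1 / (norm (z (N i)) / lam i ^ N i) / lam i ^ k" for i k
  have u_le: "norm u \<le> norm (z (N i)) / lam i ^ N i" for i using N[of 0 i] by (simp add: z_def)
  then have D0: "0 < norm (z (N i)) / lam i ^ N i" for i using u0 less_le_trans by blast
  have T0: "0 < T i k" for i k
    unfolding T_def using D0 lam0 by (metis zero_less_divide_1_iff divide_pos_pos zero_less_power)
  \<comment> \<open>Comparing the maximum with index 0 confines the first \<open>q\<close> members
    of all families to the finitely many segments in \<open>B\<close>.\<close>
  have T_le: "T i k \<le> 1 / norm u" for i k
  proof -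
    have "T i k \<le> 1 / (norm (z (N i)) / lam i ^ N i) / 1"
      unfolding T_def using D0[of i] lam1[of i] less_imp_le[OF lam1[of i]]
      by (intro divide_left_mono one_le_power mult_pos_pos) auto
    also have "\<dots> \<le> 1 / norm u"
      using u_le[of i] u0 D0[of i] by (simp only: div_by_1) (intro divide_left_mono mult_pos_pos; simp)
    finally show ?thesis .
  qed
  have Tz: "norm (T i k *\<^sub>R z k) \<le> 1" for i k
  proof -
    have "norm (T i k *\<^sub>R z k) = (norm (z k) / lam i ^ k) / (norm (z (N i)) / lam i ^ N i)"
      using lam0[of i] by (simp add: T_def abs_mult mult.commute)
    also have "\<dots> \<le> 1" using N[of k i] D0[of i] by (subst pos_divide_le_eq) simp_all
    finally show ?thesis .
  qed
  have zN: "norm (z (N i)) > 0" for i using D0[of i] lam0[of i] by (auto simp: zero_less_divide_iff)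
  have T_N: "T i (N i) = 1 / norm (z (N i))" for i using lam0[of i] by (simp add: T_def)
  define A where "A = {T i k *\<^sub>R z k | i k. True}"
  define B where "B = insert 0 (\<Union>k<q. (\<lambda>t. t *\<^sub>R z k) ` {0..1 / norm u})"
  have A: "A \<subseteq> C" "bounded A"
    using cone_scale[OF z_in less_imp_le[OF T0]] Tz
    unfolding A_def bounded_iff by blast+
  have "compact B" unfolding B_def
    by (intro compact_insert compact_UN compact_continuous_image continuous_intros) auto
  then have B: "bounded B" "compact (closure B)"
    by (auto simp: compact_imp_bounded compact_imp_closed)
  have rep: "\<exists>s a' b. 0 \<le> s \<and> s \<le> 1 \<and> a' \<in> A \<and> b \<in> B \<and> a = s *\<^sub>R (f ^^ q) a' + b"
    if aA: "a \<in> A" for a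
  proof -
    obtain i k where a: "a = T i k *\<^sub>R z k" using aA by (auto simp: A_def)
    show ?thesis
    proof (cases "k < q")
      case True
      have "T i k \<in> {0..1 / norm u}" using T0[of i k] T_le[of i k] by simp
      then have "a \<in> B" using a True unfolding B_def by blast
      then show ?thesis using aA by (intro exI[of _ 0] exI[of _ a]) auto
    next
      case False
      then have k: "k = q + (k - q)" by simp
      have "T i k = (1 / lam i ^ q) * T i (k - q)"
        unfolding T_def by (subst k) (simp add: power_add)
      moreover have "z k = (f ^^ q) (z (k - q))"
        unfolding z_def by (subst k) (simp add: funpow_add)
      moreover have "T i (k - q) *\<^sub>R (f ^^ q) (z (k - q)) = (f ^^ q) (T i (k - q) *\<^sub>R z (k - q))"
        using iter_scale[OF z_in less_imp_le[OF T0]] by simp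
      ultimately have "a = (1 / lam i ^ q) *\<^sub>R (f ^^ q) (T i (k - q) *\<^sub>R z (k - q)) + 0"
        using a by (metis add.right_neutral scaleR_scaleR)
      moreover have "0 \<in> B" "T i (k - q) *\<^sub>R z (k - q) \<in> A" by (auto simp: A_def B_def)
      moreover have "0 \<le> 1 / lam i ^ q" "1 / lam i ^ q \<le> 1"
        using lam1[of i] lam0[of i] by (auto simp: one_le_power less_imp_le)
      ultimately show ?thesis by blast
    qed
  qed
  have "T i (N i) *\<^sub>R z (N i) \<in> A" for i by (auto simp: A_def)
  then obtain w \<phi> where w: "strict_mono (\<phi> :: nat \<Rightarrow> nat)"
    "(\<lambda>i. T (\<phi> i) (N (\<phi> i)) *\<^sub>R z (N (\<phi> i))) \<longlonglongrightarrow> w" "w \<in> C"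
    using G.self_image_subseq[OF A _ _ B rep, of "\<lambda>i. T i (N i) *\<^sub>R z (N i)"] G.c_less
    by (metis mult_1 zero_le_one)
  \<comment> \<open>The scalar stays at index \<open>N\<close> while the orbit advances by
    \<open>k\<close>, as homogeneity pulls it through \<open>f ^^ k\<close>.\<close>
  have orbit: "(\<lambda>i. T (\<phi> i) (N (\<phi> i)) *\<^sub>R z (k + N (\<phi> i))) \<longlonglongrightarrow> (f ^^ k) w" for k
  proof -
    interpret I: cone_map C "f ^^ k" by (rule cone_map_iter)
    have "(f ^^ k) (T i (N i) *\<^sub>R z (N i)) = T i (N i) *\<^sub>R z (k + N i)" for i
      using iter_scale[OF z_in less_imp_le[OF T0]] by (simp add: z_def funpow_add)
    then show ?thesis
      using I.f_limit[OF _ w(2)] cone_scale[OF z_in less_imp_le[OF T0]] by simp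
  qed
  have "norm ((f ^^ k) w) \<le> 1" for k
  proof (rule LIMSEQ_le)
    show "(\<lambda>i. norm (T (\<phi> i) (N (\<phi> i)) *\<^sub>R z (k + N (\<phi> i)))) \<longlonglongrightarrow> norm ((f ^^ k) w)"
      by (rule tendsto_norm[OF orbit])
    show "(\<lambda>i. lam (\<phi> i) ^ k) \<longlonglongrightarrow> 1"
      using tendsto_power[OF LIMSEQ_subseq_LIMSEQ[OF lam_lim w(1)], of k] by (simp add: o_def)
    \<comment> \<open>The scalar of index \<open>N i\<close> exceeds that of index
      \<open>k + N i\<close> by the factor \<open>lam i ^ k\<close>, which tends to 1.\<close>
    have "norm (T i (N i) *\<^sub>R z (k + N i)) \<le> lam i ^ k" for i
    proof -
      have "T i (N i) = lam i ^ k * T i (k + N i)"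
        using lam0[of i] by (simp add: T_def power_add)
      then have "norm (T i (N i) *\<^sub>R z (k + N i)) = lam i ^ k * norm (T i (k + N i) *\<^sub>R z (k + N i))"
        using lam0[of i] by (simp add: abs_mult)
      also have "\<dots> \<le> lam i ^ k * 1" using lam0[of i] by (intro mult_left_mono Tz) simp
      finally show ?thesis by simp
    qed
    then show "\<exists>M. \<forall>i\<ge>M. norm (T (\<phi> i) (N (\<phi> i)) *\<^sub>R z (k + N (\<phi> i))) \<le> lam (\<phi> i) ^ k" by blast
  qed
  moreover have "f w - w \<in> C"
  proof (rule cone_limit)
    show "(\<lambda>i. T (\<phi> i) (N (\<phi> i)) *\<^sub>R z (1 + N (\<phi> i)) - T (\<phi> i) (N (\<phi> i)) *\<^sub>R z (N (\<phi> i))) \<longlonglongrightarrow> f w - w"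
      using tendsto_diff[OF orbit[of 1] w(2)] by simp
    show "T (\<phi> i) (N (\<phi> i)) *\<^sub>R z (1 + N (\<phi> i)) - T (\<phi> i) (N (\<phi> i)) *\<^sub>R z (N (\<phi> i)) \<in> C" for i
      using cone_scale[OF iter_incr[OF u_in u(2)] less_imp_le[OF T0]]
      unfolding z_def by (metis le_add2 scaleR_diff_right)
  qed
  moreover have "(\<lambda>i. norm (T (\<phi> i) (N (\<phi> i)) *\<^sub>R z (N (\<phi> i)))) = (\<lambda>_. 1)"
    using zN by (auto simp: fun_eq_iff T_N)
  then have "norm w = 1" using tendsto_norm[OF w(2)] LIMSEQ_unique[OF tendsto_const, of 1] by metis
  then have "w \<in> C - {0}" using w(3) by auto
  ultimately show ?thesis using fixed_point_of_bounded_orbit[OF cond] by blast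
qed

end

section \<open>Growth rates and spectral radii\<close>

lemma limsup_root_le:
  assumes "\<And>k. 0 \<le> a k" "\<And>k. a k \<le> K * L ^ k" "0 < L"
  shows "limsup (\<lambda>k. ereal (root k (a k))) \<le> ereal L"
proof -
  \<comment> \<open>A positive constant is wanted, because its \<open>k\<close>-th roots tend to
    1.\<close>
  define K' where "K' = max 1 K"
  have K': "0 < K'" "K \<le> K'" by (auto simp: K'_def)
  have "limsup (\<lambda>k. ereal (root k (a k))) \<le> limsup (\<lambda>k. ereal (root k K' * L))"
  proof (rule Limsup_mono, rule eventually_sequentiallyI[of 1])
    fix k :: nat assume k: "1 \<le> k"
    have "a k \<le> K' * L ^ k"
      using assms(2)[of k] mult_right_mono[OF K'(2), of "L ^ k"] assms(3)
      by (meson order_trans zero_le_power less_imp_le)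
    then have "root k (a k) \<le> root k (K' * L ^ k)" using k by simp
    also have "\<dots> = root k K' * L" using k assms(3) by (simp add: real_root_mult real_root_power_cancel)
    finally show "ereal (root k (a k)) \<le> ereal (root k K' * L)" by simp
  qed
  also have "\<dots> = ereal L"
  proof (rule lim_imp_Limsup)
    show "(\<lambda>k. ereal (root k K' * L)) \<longlonglongrightarrow> ereal L"
      using tendsto_mult_right[OF LIMSEQ_root_const[OF K'(1)], of L] by simp
  qed simp
  finally show ?thesis .
qed

text \<open>A rate \<open>s\<close> strictly between \<open>r\<close> and \<open>L\<close>
  eventually dominates the roots, which leaves at most \<open>(s / L) ^ k\<close>.\<close>

lemma root_limsup_growth:
  assumes nonneg: "\<And>k. 0 \<le> a k" and lim: "limsup (\<lambda>k. ereal (root k (a k))) \<le> ereal r"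
    and r: "0 < r" "r < L"
  shows "(\<lambda>k. a k / L ^ k) \<longlonglongrightarrow> 0"
proof -
  define s where "s = (r + L) / 2"
  have s: "r < s" "s < L" "0 < s" using r by (auto simp: s_def)
  have "limsup (\<lambda>k. ereal (root k (a k))) < ereal s"
    using lim s by (meson ereal_less_eq(3) le_less_trans less_ereal.simps(1))
  then have "\<forall>\<^sub>F k in sequentially. ereal (root k (a k)) < ereal s" by (rule Limsup_lessD)
  then have "\<forall>\<^sub>F k in sequentially. norm (a k / L ^ k) \<le> (s / L) ^ k"
    using eventually_gt_at_top[of 0]
  proof eventually_elim
    case (elim k)
    then have "a k < s ^ k" using real_root_pow_pos2[of k "a k"] nonneg[of k]
        power_strict_mono[of "root k (a k)" s k] by (simp add: nonneg)
    then show ?case using nonneg[of k] s r by (simp add: power_divide divide_right_mono)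
  qed
  moreover have "(\<lambda>k. (s / L) ^ k) \<longlonglongrightarrow> 0" using s r by (intro LIMSEQ_power_zero) simp
  ultimately show ?thesis by (rule Lim_null_comparison)
qed

lemma cone_essential_spectral_radius_lessD:
  assumes "cone_essential_spectral_radius \<nu> C h < r"
  obtains q c where "0 < q" "0 < c" "ereal (root q c) < r"
    "\<And>A. A \<subseteq> C \<Longrightarrow> bounded A \<Longrightarrow> \<nu> ((h ^^ q) ` A) \<le> c * \<nu> A"
proof -
  obtain q where q: "1 \<le> q" "ereal_root q (mnc_bound \<nu> C (h ^^ q)) < r"
    using assms by (auto simp: cone_essential_spectral_radius_def INF_less_iff)
  define E where "E = {ereal c | c. c > 0 \<and> (\<forall>A. A \<subseteq> C \<and> bounded A \<longrightarrow> \<nu> ((h ^^ q) ` A) \<le> c * \<nu> A)}"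
  have E: "mnc_bound \<nu> C (h ^^ q) = Inf E" by (simp add: mnc_bound_def E_def)
  \<comment> \<open>The infimum must be real before roots can be taken; \<open>ereal_root\<close>
    leaves \<open>\<infinity>\<close> unchanged, and the bound by \<open>r\<close> excludes
    it.\<close>
  have "0 \<le> Inf E" by (rule Inf_greatest) (auto simp: E_def)
  moreover have "Inf E \<noteq> \<infinity>" using q(2) unfolding E by (auto simp: ereal_root_def)
  ultimately obtain m where m: "Inf E = ereal m" "0 \<le> m" by (cases "Inf E") auto
  have "ereal (root q m) < r" using q(2) unfolding E m(1) by (simp add: ereal_root_def)
  \<comment> \<open>The gap between \<open>root q m\<close> and \<open>t\<close> leaves room for an
    admissible constant \<open>c\<close> whose root is still below \<open>r\<close>.\<close>
  then obtain t where t: "ereal (root q m) < ereal t" "ereal t < r"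
    using ereal_dense2 by blast
  have "0 \<le> t" using t(1) m(2) real_root_ge_zero[of m q] by simp
  have "m < t ^ q" using t(1) m(2) q(1) power_strict_mono[of "root q m" t q]
    by (simp add: real_root_pow_pos2)
  then have "Inf E < ereal (t ^ q)" using m(1) by simp
  then obtain c where c: "0 < c" "c < t ^ q"
    "\<And>A. A \<subseteq> C \<Longrightarrow> bounded A \<Longrightarrow> \<nu> ((h ^^ q) ` A) \<le> c * \<nu> A"
    by (auto simp: Inf_less_iff E_def)
  have "root q c < t" using c(2) q(1) \<open>0 \<le> t\<close> real_root_less_mono[of q c "t ^ q"]
    by (simp add: real_root_power_cancel)
  then have "ereal (root q c) < r" using t(2) by (meson less_ereal.simps(1) less_trans)
  then show ?thesis using that[of q c] q(1) c by simp
qed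

context cone_map
begin

lemma iter_norm_bound:
  assumes "1 \<le> M" "\<And>x. x \<in> C \<Longrightarrow> norm (f x) \<le> M * norm x" "x \<in> C"
  shows "norm ((f ^^ k) x) \<le> M ^ k * norm x"
proof (induction k)
  case (Suc k)
  have "norm ((f ^^ Suc k) x) \<le> M * norm ((f ^^ k) x)" using assms(2)[OF iter_in[OF assms(3)]] by simp
  also have "\<dots> \<le> M * (M ^ k * norm x)" using Suc assms(1) by (intro mult_left_mono) auto
  finally show ?case by (simp add: mult.assoc)
qed simp

lemma cone_spectral_radius_finite: "cone_spectral_radius C f < \<infinity>"
proof -
  obtain M where M: "1 \<le> M" "\<And>x. x \<in> C \<Longrightarrow> norm (f x) \<le> M * norm x" using f_norm_bound by blast
  have "cone_spectral_radius C f \<le> ereal M"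
    unfolding cone_spectral_radius_def
  proof (rule SUP_least, rule limsup_root_le)
    show "norm ((f ^^ k) x) \<le> norm x * M ^ k" if "x \<in> C" for x k
      using iter_norm_bound[OF M that] by (simp add: mult.commute)
  qed (use M in auto)
  then show ?thesis by auto
qed

text \<open>Were the quotients bounded along multiples of \<open>q\<close>, the linear bound on
  \<open>f\<close> would fill the fewer than \<open>q\<close> missing steps at the cost of a
  constant factor, and \<open>limsup_root_le\<close> would contradict the assumed growth.\<close>

lemma iterate_unbounded:
  assumes x: "x \<in> C" and q: "0 < q" and lam: "0 < lam" "lam < 1"
    and lim: "ereal lam < limsup (\<lambda>k. ereal (root k (norm ((f ^^ k) x))))"
  shows "\<exists>n. norm (((f ^^ q) ^^ n) x) / (lam ^ q) ^ n > K"
proof (rule ccontr)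
  assume "\<not> ?thesis"
  then have "norm ((f ^^ (q * n)) x) / lam ^ (q * n) \<le> K" for n
    by (simp add: funpow_mult not_less mult.commute[of _ q] flip: power_mult)
  then have K: "norm ((f ^^ (q * n)) x) \<le> K * lam ^ (q * n)" for n
    using lam by (simp add: pos_divide_le_eq)
  have K0: "0 \<le> K" using K[of 0] norm_ge_zero[of x] by (simp del: norm_ge_zero)
  obtain M where M: "1 \<le> M" "\<And>x. x \<in> C \<Longrightarrow> norm (f x) \<le> M * norm x" using f_norm_bound by blast
  have "norm ((f ^^ k) x) \<le> (M ^ q * K / lam ^ q) * lam ^ k" for k
  proof -
    define n s where "n = k div q" and "s = k mod q"
    have k: "k = s + q * n" by (simp add: n_def s_def)
    have s: "s \<le> q" using q by (simp add: s_def less_imp_le)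
    have "norm ((f ^^ k) x) \<le> M ^ s * norm ((f ^^ (q * n)) x)"
      unfolding k funpow_add o_apply by (rule iter_norm_bound[OF M iter_in[OF x]])
    also have "\<dots> \<le> M ^ q * (K * lam ^ (q * n))"
      using M(1) s K by (intro mult_mono power_increasing) auto
    also have "\<dots> \<le> M ^ q * (K * (lam ^ k / lam ^ q))"
    proof (intro mult_left_mono)
      have "lam ^ q * lam ^ (q * n) \<le> lam ^ s * lam ^ (q * n)"
        using lam s by (intro mult_right_mono power_decreasing) auto
      then show "lam ^ (q * n) \<le> lam ^ k / lam ^ q"
        using lam unfolding k by (simp add: pos_le_divide_eq power_add mult.commute)
    qed (use K0 M in auto)
    finally show ?thesis by simp
  qed
  then have "limsup (\<lambda>k. ereal (root k (norm ((f ^^ k) x)))) \<le> ereal lam"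
    by (rule limsup_root_le[OF norm_ge_zero _ lam(1)])
  then show False using lim by simp
qed

lemma limsup_root_scale:
  assumes t: "0 < t" and x: "x \<in> C"
  shows "limsup (\<lambda>k. ereal (root k (norm (((\<lambda>x. t *\<^sub>R f x) ^^ k) x)))) =
    ereal t * limsup (\<lambda>k. ereal (root k (norm ((f ^^ k) x))))"
proof -
  have "\<forall>\<^sub>F k in sequentially. ereal (root k (norm (((\<lambda>x. t *\<^sub>R f x) ^^ k) x))) =
    ereal t * ereal (root k (norm ((f ^^ k) x)))"
    using eventually_gt_at_top[of 0]
    by eventually_elim (use t in \<open>simp add: scaled_iter[OF x t] real_root_mult real_root_power_cancel\<close>)
  then have "limsup (\<lambda>k. ereal (root k (norm (((\<lambda>x. t *\<^sub>R f x) ^^ k) x)))) =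
    limsup (\<lambda>k. ereal t * ereal (root k (norm ((f ^^ k) x))))"
    by (rule Limsup_eq)
  also have "\<dots> = ereal t * limsup (\<lambda>k. ereal (root k (norm ((f ^^ k) x))))"
    using t by (intro Limsup_ereal_mult_left) auto
  finally show ?thesis .
qed

end

section \<open>Normalisation to spectral radius one\<close>

theorem corollary5p4:
  fixes C :: "'a::banach set"
    and h :: "'a \<Rightarrow> 'a"
    and \<nu> :: "'a set \<Rightarrow> real"
  assumes "homogeneous_mnc \<nu>"
    and "proper_cone C"
    and "sup_semilattice_on C C"
    and "h \<in> C \<rightarrow> C"
    and "continuous_on C h"
    and "homogeneous_on C h"
    and "order_preserving_on C h"
    and "cone_essential_spectral_radius \<nu> C h < cone_spectral_radius C h"
    and "\<exists>m::nat. \<forall>x\<in>C - {0}. periodic_point h x \<longrightarrow>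
           (\<exists>u::nat \<Rightarrow> 'a. (\<forall>i\<in>{1..m}. u i \<in> C) \<and>
              {(h ^^ j) x | j. True} \<subseteq> (\<Union>i\<in>{1..m}. cone_part C (u i)))"
  shows "\<exists>y\<in>C - {0}. \<exists>r::real. ereal r = cone_spectral_radius C h \<and> h y = r *\<^sub>R y"
proof -
  note mnc = assms(1) and sup = assms(3)
  interpret H: cone_map C h using assms by unfold_locales
  obtain q c where q: "0 < q" and c: "0 < c" "ereal (root q c) < cone_spectral_radius C h"
    "\<And>A. A \<subseteq> C \<Longrightarrow> bounded A \<Longrightarrow> \<nu> ((h ^^ q) ` A) \<le> c * \<nu> A"
    using cone_essential_spectral_radius_lessD[OF assms(8)] by blast
  have rc: "0 < root q c" using q c by simp
  obtain r where r: "cone_spectral_radius C h = ereal r"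
    using c(2) H.cone_spectral_radius_finite by (cases "cone_spectral_radius C h") auto
  have r_gt: "root q c < r" using c(2) r by simp
  then have r0: "0 < r" using rc by simp
  have "c < r ^ q" using power_strict_mono[OF r_gt _ q] rc c(1) q
    by (simp add: real_root_pow_pos2)
  \<comment> \<open>Dividing by \<open>r\<close> scales the condensing constant of the
    \<open>q\<close>-th iterate to \<open>c / r ^ q < 1\<close>; \<open>e_le\<close> and
    \<open>e_gt\<close> below say that the spectral radius becomes 1.\<close>
  define f where "f x = (1 / r) *\<^sub>R h x" for x
  have ir: "0 < 1 / r" using r0 by simp
  interpret F: cone_map C f unfolding f_def[abs_def] by (rule H.cone_map_scale[OF ir])
  have f_iter: "(f ^^ n) x = (1 / r) ^ n *\<^sub>R (h ^^ n) x" if "x \<in> C" for n x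
    unfolding f_def[abs_def] by (rule H.scaled_iter[OF that ir])
  have cond: "condensing_cone_map C (f ^^ q) \<nu> (c / r ^ q)"
  proof (intro condensing_cone_map.intro F.cone_map_iter condensing_cone_map_axioms.intro mnc)
    show "0 < c / r ^ q" "c / r ^ q < 1" using c r0 \<open>c < r ^ q\<close> by auto
    fix A assume A: "A \<subseteq> C" "bounded A"
    interpret Hq: cone_map C "h ^^ q" by (rule H.cone_map_iter)
    have "(f ^^ q) ` A = (\<lambda>x. (1 / r) ^ q *\<^sub>R x) ` ((h ^^ q) ` A)"
      using A(1) by (subst image_image) (rule image_cong, auto simp: f_iter)
    moreover have "bounded ((h ^^ q) ` A)" using Hq.bounded_image[OF A] .
    ultimately have "\<nu> ((f ^^ q) ` A) = (1 / r) ^ q * \<nu> ((h ^^ q) ` A)"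
      using mnc r0 by (simp add: homogeneous_mnc_def)
    also have "\<dots> \<le> (1 / r) ^ q * (c * \<nu> A)"
      using c(3)[OF A] r0 by (intro mult_left_mono) auto
    finally show "\<nu> ((f ^^ q) ` A) \<le> c / r ^ q * \<nu> A" by (simp add: power_divide)
  qed
  define e where "e x = limsup (\<lambda>k. ereal (root k (norm ((f ^^ k) x))))" for x
  have e: "e x = ereal (1 / r) * limsup (\<lambda>k. ereal (root k (norm ((h ^^ k) x))))" if "x \<in> C" for x
    unfolding e_def f_def[abs_def] by (rule H.limsup_root_scale[OF ir that])
  have e_le: "e x \<le> ereal 1" if "x \<in> C" for x
  proof -
    have "limsup (\<lambda>k. ereal (root k (norm ((h ^^ k) x)))) \<le> ereal r"
      unfolding r[symmetric] cone_spectral_radius_def by (rule SUP_upper[OF that])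
    then have "e x \<le> ereal (1 / r) * ereal r"
      unfolding e[OF that] using ir by (intro ereal_mult_left_mono) auto
    then show ?thesis using r0 by simp
  qed
  have e_gt: "\<exists>x\<in>C. ereal lam < e x" if lam: "0 < lam" "lam < 1" for lam
  proof -
    have "ereal (lam * r) < cone_spectral_radius C h" using lam r r0 by simp
    then obtain x where x: "x \<in> C"
      "ereal (lam * r) < limsup (\<lambda>k. ereal (root k (norm ((h ^^ k) x))))"
      by (auto simp: cone_spectral_radius_def less_SUP_iff)
    have "ereal (1 / r) * ereal (lam * r) < e x"
      unfolding e[OF x(1)] using ir x(2) by (intro ereal_mult_strict_left_mono) auto
    then show ?thesis using x(1) r0 by auto
  qed
  interpret G: condensing_cone_map C "f ^^ q" \<nu> "c / r ^ q" by fact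
  have "\<exists>x\<in>C. \<forall>K. \<exists>n. norm (((f ^^ q) ^^ n) x) / lam ^ n > K" if lam: "0 < lam" "lam < 1" for lam
  proof -
    \<comment> \<open>The rate \<open>lam\<close> for \<open>f ^^ q\<close> corresponds to the rate
      \<open>root q lam\<close> for \<open>f\<close>.\<close>
    have "0 < root q lam" "root q lam < 1" "root q lam ^ q = lam"
      using lam q by (simp_all add: real_root_pow_pos2)
    then show ?thesis
      using e_gt[of "root q lam"] F.iterate_unbounded[OF _ q, of _ "root q lam"]
      unfolding e_def by metis
  qed
  from G.subeigenvector_exists[OF this]
  obtain w where "w \<in> C - {0}" "(f ^^ q) w - w \<in> C" by blast
  from F.subeigenvector_of_iterate[OF sup this q]
  obtain u where u: "u \<in> C - {0}" "f u - u \<in> C" by blast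
  have "(\<lambda>n. norm ((f ^^ n) u) / lam ^ n) \<longlonglongrightarrow> 0" if "1 < lam" for lam
    using root_limsup_growth[of "\<lambda>n. norm ((f ^^ n) u)" 1 lam] e_le[of u] u that
    by (simp add: e_def one_ereal_def)
  from F.fixed_point_of_subeigenvector[OF cond q u this]
  obtain y where y: "y \<in> C - {0}" "f y = y" by blast
  then have "r *\<^sub>R y = r *\<^sub>R f y" by simp
  then have "h y = r *\<^sub>R y" using r0 by (simp add: f_def)
  then show ?thesis using y r by metis
qed

end
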